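(* Let $X$ and $Y$ be Banach spaces with origins $\theta_X,\theta_Y$, let $K\subseteq Y$ be a closed convex pointed cone with $K\neq\{\theta_Y\}$, let $A\subseteq X$ be a nonempty convex open set, and let $T:A\to Y$ be a single-valued mapping. Let $\bar x\in A$. Suppose that $T$ is Gâteaux differentiable at $\bar x$. Then we have: (i) If $T$ has an (absolute) $\preccurlyeq_K$-maximum (or (absolute) $\preccurlyeq_K$-minimum) value in $A$ at $\bar x$, then $\bar x$ is a generalized critical point of $T$ with $T'(\bar x)(v)=\theta_Y$ for every $v\in X\setminus\{\theta_X\}$. That is, $E(T)\subseteq dT^0$. (ii) Inversely, if $T'(\bar x)(v)\neq\theta_Y$ for some $v\in X\setminus\{\theta_X\}$, then $T$ takes neither a $\preccurlyeq_K$-maximum nor a $\preccurlyeq_K$-minimum value at $\bar x$.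
   Context: The partial order on $Y$ induced by $K$ is $y_1\preccurlyeq_K y_2\iff y_2-y_1\in K$; pointed means $K\cap(-K)=\{\theta_Y\}$. $T$ is Gâteaux differentiable at $\bar x$ if for every $v\in X\setminus\{\theta_X\}$ the norm limit $T'(\bar x)(v)=\lim_{t\to0}\frac{T(\bar x+tv)-T(\bar x)}{t}$ ($t$ real) exists in $Y$. A point $\bar x\in A$ is a generalized critical point of $T$ if $T$ is Gâteaux differentiable at $\bar x$ and $T'(\bar x)(v)=\theta_Y$ for every $v\in X\setminus\{\theta_X\}$; $dT^0$ is the set of all generalized critical points of $T$ in $A$. $T$ has an (absolute) $\preccurlyeq_K$-maximum value in $A$ at $\bar x$ if $T(x)\preccurlyeq_K T(\bar x)$ for all $x\in A$, and an (absolute) $\preccurlyeq_K$-minimum value in $A$ at $\bar x$ if $T(\bar x)\preccurlyeq_K T(x)$ for all $x\in A$; in either case $\bar x$ is called a $\preccurlyeq_K$-extreme point of $T$. $E(T)$ is the set of all $\preccurlyeq_K$-extreme points of $T$ in $A$.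
   Formalization: The inclusion E(T) ⊆ dT^0 is stated assuming T is Gâteaux differentiable at every point of E(T); with differentiability only at x̄ it fails, e.g. T=|·| on A=(-1,1), K=[0,∞), x̄=1/2, where 0 is in E(T) but not in dT^0. *)

theory Defs
  imports "HOL-Analysis.Analysis"
begin

definition cone_le :: "'b::real_vector set \<Rightarrow> 'b \<Rightarrow> 'b \<Rightarrow> bool" where
  "cone_le K y1 y2 \<longleftrightarrow> y2 - y1 \<in> K"

definition pointed :: "'b::real_vector set \<Rightarrow> bool" where
  "pointed K \<longleftrightarrow> K \<inter> uminus ` K = {0}"

text \<open>
  A mapping from an open set A into Y is represented by a total function T. For x in A the
  difference quotients below only involve values of T on A once t is close enough to 0, so the
  values of T outside A are irrelevant.
\<close>

definition gateaux_differentiable_at ::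
    "('a::real_normed_vector \<Rightarrow> 'b::real_normed_vector) \<Rightarrow> 'a \<Rightarrow> bool" where
  "gateaux_differentiable_at T x \<longleftrightarrow>
     (\<forall>v. v \<noteq> 0 \<longrightarrow> (\<exists>l. ((\<lambda>t::real. (T (x + t *\<^sub>R v) - T x) /\<^sub>R t) \<longlongrightarrow> l) (at 0)))"

text \<open>Meaningful only where the limit exists.\<close>

definition gateaux_deriv ::
    "('a::real_normed_vector \<Rightarrow> 'b::real_normed_vector) \<Rightarrow> 'a \<Rightarrow> 'a \<Rightarrow> 'b" where
  "gateaux_deriv T x v = Lim (at 0) (\<lambda>t::real. (T (x + t *\<^sub>R v) - T x) /\<^sub>R t)"

definition generalized_critical_point ::
    "'a::real_normed_vector set \<Rightarrow> ('a \<Rightarrow> 'b::real_normed_vector) \<Rightarrow> 'a \<Rightarrow> bool" where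
  "generalized_critical_point A T x \<longleftrightarrow>
     x \<in> A \<and> gateaux_differentiable_at T x \<and> (\<forall>v. v \<noteq> 0 \<longrightarrow> gateaux_deriv T x v = 0)"

definition generalized_critical_points ::
    "'a::real_normed_vector set \<Rightarrow> ('a \<Rightarrow> 'b::real_normed_vector) \<Rightarrow> 'a set" where
  "generalized_critical_points A T = {x. generalized_critical_point A T x}"

definition has_max_value_at ::
    "'b::real_vector set \<Rightarrow> 'a set \<Rightarrow> ('a \<Rightarrow> 'b) \<Rightarrow> 'a \<Rightarrow> bool" where
  "has_max_value_at K A T x \<longleftrightarrow> x \<in> A \<and> (\<forall>y\<in>A. cone_le K (T y) (T x))"

definition has_min_value_at ::
    "'b::real_vector set \<Rightarrow> 'a set \<Rightarrow> ('a \<Rightarrow> 'b) \<Rightarrow> 'a \<Rightarrow> bool" where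
  "has_min_value_at K A T x \<longleftrightarrow> x \<in> A \<and> (\<forall>y\<in>A. cone_le K (T x) (T y))"

definition extreme_points_of_map ::
    "'b::real_vector set \<Rightarrow> 'a set \<Rightarrow> ('a \<Rightarrow> 'b) \<Rightarrow> 'a set" where
  "extreme_points_of_map K A T = {x. has_max_value_at K A T x \<or> has_min_value_at K A T x}"

end

theory Submission
  imports Defs
begin

text \<open>
  At an extreme point the difference quotients along v lie in K for t of one sign and in -K for t
  of the other. Since K is closed, the two-sided limit lies in both K and -K, hence vanishes.
\<close>

text \<open>\<open>gateaux_deriv\<close> is a bare \<open>Lim\<close>, so it carries information
  only once a limit is known to exist; uniqueness of limits then identifies it with the witness from
  differentiability.\<close>

lemma gateaux_quotient_tendsto:
  assumes "gateaux_differentiable_at T x" "v \<noteq> 0"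
  shows "((\<lambda>t. (T (x + t *\<^sub>R v) - T x) /\<^sub>R t) \<longlongrightarrow> gateaux_deriv T x v) (at 0)"
proof -
  obtain l where l: "((\<lambda>t. (T (x + t *\<^sub>R v) - T x) /\<^sub>R t) \<longlongrightarrow> l) (at 0)"
    using assms unfolding gateaux_differentiable_at_def by blast
  then have "gateaux_deriv T x v = l"
    unfolding gateaux_deriv_def by (intro tendsto_Lim) simp_all
  with l show ?thesis
    by simp
qed

lemma eventually_line_in_open:
  fixes x v :: "'a::real_normed_vector"
  assumes "open A" "x \<in> A"
  shows "\<forall>\<^sub>F t in at 0. x + t *\<^sub>R v \<in> A"
proof -
  have "((\<lambda>t. x + t *\<^sub>R v) \<longlongrightarrow> x + 0 *\<^sub>R v) (at (0::real))"
    by (intro tendsto_intros)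
  then show ?thesis
    using assms by (auto dest: topological_tendstoD)
qed

text \<open>With \<open>pointed_negations\<close> and \<open>closed_negations\<close>, this makes -K
  an admissible cone, so that maxima can be treated as minima for -K.\<close>

lemma cone_negations:
  assumes "cone K"
  shows "cone (uminus ` K)"
  unfolding cone_def
proof (intro ballI allI impI)
  fix y and c :: real
  assume "y \<in> uminus ` K" "0 \<le> c"
  then obtain k where "k \<in> K" "y = - k"
    by blast
  then have "c *\<^sub>R y = - (c *\<^sub>R k)" "c *\<^sub>R k \<in> K"
    using mem_cone[OF assms _ \<open>0 \<le> c\<close>] by simp_all
  then show "c *\<^sub>R y \<in> uminus ` K"
    by (rule image_eqI)
qed

lemma pointed_negations: "pointed K \<Longrightarrow> pointed (uminus ` K)"
  by (simp add: pointed_def image_image Int_commute)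

lemma gateaux_deriv_eq_0_if_has_min_value_at:
  assumes "closed K" "cone K" "pointed K" "open A"
    and "gateaux_differentiable_at T x" "has_min_value_at K A T x" "v \<noteq> 0"
  shows "gateaux_deriv T x v = 0"
proof -
  let ?q = "\<lambda>t::real. (T (x + t *\<^sub>R v) - T x) /\<^sub>R t"
  let ?l = "gateaux_deriv T x v"
  have lim: "(?q \<longlongrightarrow> ?l) (at 0)"
    using gateaux_quotient_tendsto assms(5,7) .
  have min: "T y - T x \<in> K" if "y \<in> A" for y
    using assms(6) that by (simp add: has_min_value_at_def cone_le_def)
  have "x \<in> A"
    using assms(6) by (simp add: has_min_value_at_def)
  with \<open>open A\<close> have ev: "\<forall>\<^sub>F t in at 0. x + t *\<^sub>R v \<in> A"
    by (rule eventually_line_in_open)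
  have "?l \<in> K"
  proof (rule Lim_in_closed_set[OF \<open>closed K\<close>])
    show "\<forall>\<^sub>F t in at_right 0. ?q t \<in> K"
      \<comment> \<open>For small t > 0 the quotient is an increment of \<open>T\<close> in K,
        scaled by the positive factor \<open>inverse t\<close>.\<close>
      using filter_leD[OF at_le[OF subset_UNIV] ev] eventually_at_right_less
      by eventually_elim (auto intro!: mem_cone[OF \<open>cone K\<close>] min)
    show "(?q \<longlongrightarrow> ?l) (at_right 0)"
      using lim by (rule tendsto_within_subset) simp
  qed simp
  moreover have "- ?l \<in> K"
  proof (rule Lim_in_closed_set[OF \<open>closed K\<close>])
    show "\<forall>\<^sub>F t in at_left 0. - ?q t \<in> K"
      \<comment> \<open>The bound -1 is arbitrary: only t < 0 matters.\<close>
      using filter_leD[OF at_le[OF subset_UNIV] ev] eventually_at_left_real[of "-1" 0, simplified]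
    proof eventually_elim
      case (elim t)
      \<comment> \<open>The increment is still in K, but \<open>inverse t\<close> is negative;
        moving the sign into the scalar makes it nonnegative, as \<open>mem_cone\<close>
        requires.\<close>
      then have "(- inverse t) *\<^sub>R (T (x + t *\<^sub>R v) - T x) \<in> K"
        by (intro mem_cone[OF \<open>cone K\<close>] min) auto
      then show ?case by (simp only: scaleR_minus_left)
    qed
    show "((\<lambda>t. - ?q t) \<longlongrightarrow> - ?l) (at_left 0)"
      using tendsto_minus[OF lim] by (rule tendsto_within_subset) simp
  qed simp
  ultimately have "?l \<in> K \<inter> uminus ` K"
    by (metis IntI image_eqI minus_minus)
  with \<open>pointed K\<close> show ?thesis
    by (simp add: pointed_def)
qed

text \<open>Negating the cone reverses the order it induces.\<close>

lemma has_max_value_at_iff_min_negations: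
  "has_max_value_at K A T x \<longleftrightarrow> has_min_value_at (uminus ` K) A T x"
proof -
  have "a - b \<in> uminus ` K \<longleftrightarrow> b - a \<in> K" for a b
  proof
    assume "b - a \<in> K"
    then show "a - b \<in> uminus ` K"
      using imageI[of "b - a" K uminus] by simp
  next
    assume "a - b \<in> uminus ` K"
    then obtain k where "k \<in> K" "a - b = - k"
      by blast
    then show "b - a \<in> K"
      using minus_diff_eq[of a b] by simp
  qed
  then show ?thesis
    by (simp add: has_max_value_at_def has_min_value_at_def cone_le_def)
qed

lemma gateaux_deriv_eq_0_if_extreme:
  assumes "closed K" "cone K" "pointed K" "open A"
    and "gateaux_differentiable_at T x" "x \<in> extreme_points_of_map K A T" "v \<noteq> 0"
  shows "gateaux_deriv T x v = 0"
proof (cases "has_min_value_at K A T x")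
  case True
  with assms show ?thesis
    by (intro gateaux_deriv_eq_0_if_has_min_value_at[of K A])
next
  case False
  with assms(6) have "has_min_value_at (uminus ` K) A T x"
    by (simp add: extreme_points_of_map_def has_max_value_at_iff_min_negations)
  then show ?thesis
    using closed_negations[OF assms(1)] cone_negations[OF assms(2)] pointed_negations[OF assms(3)]
      assms(4,5,7)
    by (intro gateaux_deriv_eq_0_if_has_min_value_at[of "uminus ` K" A])
qed

text \<open>Membership in \<open>A\<close>, which a generalized critical point also requires, is
  built into both kinds of extreme value.\<close>

lemma generalized_critical_point_if_extreme:
  assumes "closed K" "cone K" "pointed K" "open A"
    and "gateaux_differentiable_at T x" "x \<in> extreme_points_of_map K A T"
  shows "generalized_critical_point A T x"
  using assms gateaux_deriv_eq_0_if_extreme[OF assms]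
  by (auto simp: generalized_critical_point_def extreme_points_of_map_def
      has_max_value_at_def has_min_value_at_def)

text \<open>Differentiability at \<open>x\<close> says nothing about other extreme points, so the
  inclusion of sets carries its own differentiability premise.\<close>

theorem corollary2p5:
  fixes K :: "'b::banach set"
    and A :: "'a::banach set"
    and T :: "'a \<Rightarrow> 'b"
    and x :: 'a
  assumes "closed K" and "convex K" and "cone K" and "pointed K" and "K \<noteq> {0}"
    and "A \<noteq> {}" and "convex A" and "open A"
    and "x \<in> A"
    and "gateaux_differentiable_at T x"
  shows "(has_max_value_at K A T x \<or> has_min_value_at K A T x \<longrightarrow>
            generalized_critical_point A T x \<and> (\<forall>v. v \<noteq> 0 \<longrightarrow> gateaux_deriv T x v = 0))
       \<and> ((\<forall>z\<in>extreme_points_of_map K A T. gateaux_differentiable_at T z) \<longrightarrow>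
            extreme_points_of_map K A T \<subseteq> generalized_critical_points A T)
       \<and> ((\<exists>v. v \<noteq> 0 \<and> gateaux_deriv T x v \<noteq> 0) \<longrightarrow>
            \<not> has_max_value_at K A T x \<and> \<not> has_min_value_at K A T x)"
proof -
  \<comment> \<open>An arbitrary \<open>z\<close> serves the inclusion; the instance at
    \<open>x\<close> gives the first claim and, by contraposition, the last.\<close>
  have critical: "generalized_critical_point A T z"
    if "gateaux_differentiable_at T z" "z \<in> extreme_points_of_map K A T" for z
    using generalized_critical_point_if_extreme assms(1,3,4,8) that .
  show ?thesis
    using critical[of x] critical assms(10)
    by (auto simp: extreme_points_of_map_def generalized_critical_points_def
        generalized_critical_point_def)
qed

end
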